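(* Let $p\in(0,1)^n$, $k\in\{0,\dots,n\}$ and $\pi=\pi(p,k)$. Then for any nonempty $A\subset\mathcal{B}_n$, \[ \pi(A)\,\pi\Big(\exp\big(d_T^2(\cdot,A)/84\big)\Big)\le 1, \] where $d_T(x,A)=\sup\{d_\alpha(x,A):\alpha\in[0,\infty)^n,\ |\alpha|\le1\}$.
   Context: $\mathcal{B}_n=\{0,1\}^n$. For $p\in(0,1)^n$ let $B=(B_1,\dots,B_n)$ be independent Bernoulli variables with $\mathbb{P}(B_i=1)=p_i$; $\pi(p,k)$ is the law of $B$ conditioned on $\sum_iB_i=k$. For $\alpha\in[0,\infty)^n$, $d_\alpha(x,y)=\sum_i\alpha_i\mathbf{1}\{x_i\neq y_i\}$, $d_\alpha(x,A)=\min_{y\in A}d_\alpha(x,y)$, and $|\alpha|$ is the Euclidean norm. $\pi(g)=\int g\,d\pi$. *)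

theory Defs
  imports "HOL-Analysis.Analysis"
begin

definition cube :: "nat \<Rightarrow> bool list set" where
  "cube n = {x. length x = n}"

definition ones :: "bool list \<Rightarrow> nat" where
  "ones x = card {i. i < length x \<and> x ! i}"

text \<open>Product Bernoulli weight P(B = x) for independent B_i with P(B_i = 1) = p i.\<close>
definition bern_weight :: "(nat \<Rightarrow> real) \<Rightarrow> bool list \<Rightarrow> real" where
  "bern_weight p x = (\<Prod>i<length x. if x ! i then p i else 1 - p i)"

text \<open>pi(p,k): law of B conditioned on sum B_i = k (point masses on cube n).\<close>
definition cond_bern :: "nat \<Rightarrow> (nat \<Rightarrow> real) \<Rightarrow> nat \<Rightarrow> bool list \<Rightarrow> real" where
  "cond_bern n p k x =
     (if x \<in> cube n \<and> ones x = k
      then bern_weight p x / (\<Sum>y\<in>{y\<in>cube n. ones y = k}. bern_weight p y)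
      else 0)"

definition cb_prob :: "nat \<Rightarrow> (nat \<Rightarrow> real) \<Rightarrow> nat \<Rightarrow> bool list set \<Rightarrow> real" where
  "cb_prob n p k A = (\<Sum>x\<in>A \<inter> cube n. cond_bern n p k x)"

definition cb_expect :: "nat \<Rightarrow> (nat \<Rightarrow> real) \<Rightarrow> nat \<Rightarrow> (bool list \<Rightarrow> real) \<Rightarrow> real" where
  "cb_expect n p k g = (\<Sum>x\<in>cube n. cond_bern n p k x * g x)"

definition d_alpha :: "nat \<Rightarrow> (nat \<Rightarrow> real) \<Rightarrow> bool list \<Rightarrow> bool list \<Rightarrow> real" where
  "d_alpha n \<alpha> x y = (\<Sum>i<n. \<alpha> i * (if x ! i \<noteq> y ! i then 1 else 0))"

definition d_alpha_set :: "nat \<Rightarrow> (nat \<Rightarrow> real) \<Rightarrow> bool list \<Rightarrow> bool list set \<Rightarrow> real" where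
  "d_alpha_set n \<alpha> x A = Min ((\<lambda>y. d_alpha n \<alpha> x y) ` A)"

definition d_T :: "nat \<Rightarrow> bool list \<Rightarrow> bool list set \<Rightarrow> real" where
  "d_T n x A = (SUP \<alpha>\<in>{\<alpha>. (\<forall>i<n. 0 \<le> \<alpha> i) \<and> sqrt (\<Sum>i<n. (\<alpha> i)\<^sup>2) \<le> 1}.
                   d_alpha_set n \<alpha> x A)"

end

theory Submission
  imports Defs
begin

text \<open>
  Identify configurations with \<open>k\<close>-subsets; then \<open>\<pi>(p,k)\<close> gives \<open>S\<close> a mass proportional to the product
  over \<open>S\<close> of the odds \<open>p\<^sub>i / (1 - p\<^sub>i)\<close>. To compare the laws given \<open>j \<notin> S\<close> and given \<open>j \<in> S\<close>, draw \<open>S\<close>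
  from the first and \<open>X\<close> from the second independently and move a uniformly random \<open>i \<in> S - X\<close> of \<open>S\<close>
  to \<open>j\<close>: since \<open>(S, X) \<mapsto> (S - i + j, X - j + i)\<close> preserves the product of the masses, this is a coupling.
  Revealing the coordinates in uniformly random order yields a modified logarithmic Sobolev inequality
  for exchange dynamics in which every coordinate is touched at a bounded rate.

  For an optimal weight vector \<open>\<alpha>\<close> at \<open>x\<close>, exchanging coordinates \<open>i\<close> and \<open>j\<close> decreases \<open>d\<^sub>T\<close> by at most
  \<open>\<alpha>\<^sub>i + \<alpha>\<^sub>j\<close>, and decreases \<open>f = d\<^sub>T\<^sup>2\<close> by at most 2. Because \<open>|\<alpha>| \<le> 1\<close>, this gives
  \<open>Ent(exp(t f)) \<le> 32 t\<^sup>2 \<pi>(f exp(t f))\<close> for all \<open>t \<ge> -1/2\<close>. The Herbst argument on both sides of 0 then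
  bounds \<open>\<pi>(exp(f/84))\<close> by the inverse of \<open>\<pi>(exp(-f/2))\<close>, which is at least \<open>\<pi>(A)\<close>.
\<close>

section \<open>Entropy on a finite space\<close>

text \<open>Apply \<open>ln t \<le> t - 1\<close> with \<open>t = b i * A / (a i * B)\<close> to
  each term, where \<open>A\<close> and \<open>B\<close> are the two totals. The corrections
  \<open>a i - b i * (A / B)\<close> sum to zero.\<close>

lemma log_sum_ineq:
  fixes a b :: "'i \<Rightarrow> real"
  assumes "finite I" "I \<noteq> {}" and a: "\<And>i. i \<in> I \<Longrightarrow> 0 < a i" and b: "\<And>i. i \<in> I \<Longrightarrow> 0 < b i"
  shows "sum a I * (ln (sum a I) - ln (sum b I)) \<le> (\<Sum>i\<in>I. a i * (ln (a i) - ln (b i)))"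
proof -
  define A B where "A = sum a I" and "B = sum b I"
  have A: "A > 0" and B: "B > 0"
    unfolding A_def B_def using assms by (auto intro!: sum_pos)
  have "a i * (ln A - ln B) + (a i - b i * (A / B)) \<le> a i * (ln (a i) - ln (b i))" if i: "i \<in> I" for i
  proof -
    define t where "t = b i * A / (a i * B)"
    have t: "t > 0" using a[OF i] b[OF i] A B by (simp add: t_def)
    have "ln t = ln (b i) + ln A - ln (a i) - ln B"
      using a[OF i] b[OF i] A B by (simp add: t_def ln_div ln_mult)
    moreover have "ln t \<le> t - 1" using t by (rule ln_le_minus_one)
    ultimately have "a i * (ln (b i) + ln A - ln (a i) - ln B) \<le> a i * (t - 1)"
      using a[OF i] by simp
    moreover have "a i * t = b i * (A / B)" using a[OF i] B by (simp add: t_def field_simps)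
    ultimately show ?thesis by (simp add: algebra_simps)
  qed
  then have "(\<Sum>i\<in>I. a i * (ln A - ln B) + (a i - b i * (A / B))) \<le> (\<Sum>i\<in>I. a i * (ln (a i) - ln (b i)))"
    by (rule sum_mono)
  also have "(\<Sum>i\<in>I. a i * (ln A - ln B) + (a i - b i * (A / B))) = A * (ln A - ln B) + (A - B * (A / B))"
    unfolding sum.distrib sum_subtractf sum_distrib_right [symmetric] A_def B_def ..
  finally show ?thesis using B by (simp add: A_def B_def)
qed

text \<open>For positive arguments this is a ln(a/b) + b ln(b/a), the symmetrised relative entropy.
  It is the integrand of the Dirichlet form of F against ln F in a modified logarithmic Sobolev
  inequality.\<close>

definition psi :: "real \<Rightarrow> real \<Rightarrow> real" where
  "psi a b = (a - b) * (ln a - ln b)"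

lemma psi_commute: "psi a b = psi b a"
  by (simp add: psi_def algebra_simps)

lemma psi_scale:
  assumes "c > 0" "a > 0" "b > 0"
  shows "psi (c * a) (c * b) = c * psi a b"
  using assms by (simp add: psi_def ln_mult algebra_simps)

text \<open>The log-sum inequality in both directions, added up. Through this subadditivity a
  coupling of two measures bounds \<open>psi\<close> of their integrals.\<close>

lemma psi_sum:
  assumes "finite I" and a: "\<And>i. i \<in> I \<Longrightarrow> 0 < a i" and b: "\<And>i. i \<in> I \<Longrightarrow> 0 < b i"
  shows "psi (sum a I) (sum b I) \<le> (\<Sum>i\<in>I. psi (a i) (b i))"
proof (cases "I = {}")
  case False
  have "psi (sum a I) (sum b I) =
    sum a I * (ln (sum a I) - ln (sum b I)) + sum b I * (ln (sum b I) - ln (sum a I))"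
    by (simp add: psi_def algebra_simps)
  also have "\<dots> \<le> (\<Sum>i\<in>I. a i * (ln (a i) - ln (b i))) + (\<Sum>i\<in>I. b i * (ln (b i) - ln (a i)))"
    by (intro add_mono log_sum_ineq) (use assms False in auto)
  also have "\<dots> = (\<Sum>i\<in>I. psi (a i) (b i))"
    by (simp add: psi_def sum.distrib [symmetric] algebra_simps)
  finally show ?thesis .
qed (simp add: psi_def)

text \<open>The weights are not normalised: with total mass W this is W times the entropy of
  \<open>F\<close> under w/W. Entropies of disjoint blocks can then be added without
  rescaling.\<close>

definition ent :: "'b set \<Rightarrow> ('b \<Rightarrow> real) \<Rightarrow> ('b \<Rightarrow> real) \<Rightarrow> real" where
  "ent D w F = (\<Sum>S\<in>D. w S * (F S * ln (F S)))
     - (\<Sum>S\<in>D. w S * F S) * ln ((\<Sum>S\<in>D. w S * F S) / (\<Sum>S\<in>D. w S))"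

text \<open>Ent \<open>\<le>\<close> Cov(F, ln F) on a two-point space, by concavity of the logarithm.\<close>
lemma two_point_ent:
  fixes y z :: real
  assumes y: "y > 0" and z: "z > 0" and a: "a > 0" and b: "b > 0"
  shows "y * a * ln a + z * b * ln b - (y * a + z * b) * ln ((y * a + z * b) / (y + z))
    \<le> y * z / (y + z) * psi a b"
proof -
  have "y / (y + z) * ln a + z / (y + z) * ln b \<le> ln (y / (y + z) * a + z / (y + z) * b)"
    using concave_onD[OF ln_concave, of "z / (y + z)" a b] assms
    by (simp add: field_simps)
  also have "y / (y + z) * a + z / (y + z) * b = (y * a + z * b) / (y + z)"
    by (simp add: add_divide_distrib)
  finally have "(y * a + z * b) * (y / (y + z) * ln a + z / (y + z) * ln b)
      \<le> (y * a + z * b) * ln ((y * a + z * b) / (y + z))"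
    using assms by (intro mult_left_mono) auto
  moreover have "y * a * ln a + z * b * ln b - (y * a + z * b) * (y / (y + z) * ln a + z / (y + z) * ln b)
     = y * z / (y + z) * psi a b"
    using assms by (simp add: psi_def divide_simps) (simp add: algebra_simps)
  ultimately show ?thesis by linarith
qed

text \<open>Chain rule: what remains after the entropies inside the blocks is the two-point entropy
  of the block means. Homogeneity of \<open>psi\<close> puts the bound in cross-multiplied form, the
  products of masses on which a coupling of the blocks acts.\<close>

lemma ent_Un_le:
  fixes A B :: "'b set" and w F :: "'b \<Rightarrow> real"
  defines "Z \<equiv> \<lambda>D. \<Sum>S\<in>D. w S" and "M \<equiv> \<lambda>D. \<Sum>S\<in>D. w S * F S"
  assumes fin: "finite A" "finite B" and disj: "A \<inter> B = {}"
    and w: "\<And>S. S \<in> A \<union> B \<Longrightarrow> 0 < w S" and F: "\<And>S. S \<in> A \<union> B \<Longrightarrow> 0 < F S"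
  shows "ent (A \<union> B) w F \<le> ent A w F + ent B w F + psi (Z B * M A) (Z A * M B) / Z (A \<union> B)"
proof (cases "A = {} \<or> B = {}")
  case True
  then show ?thesis by (auto simp: ent_def psi_def Z_def M_def)
next
  case False
  have pos: "Z A > 0" "Z B > 0" "M A > 0" "M B > 0"
    unfolding Z_def M_def using False fin w F by (auto intro!: sum_pos)
  define a b where "a = M A / Z A" and "b = M B / Z B"
  have ab: "a > 0" "b > 0" using pos by (auto simp: a_def b_def)
  have Mab: "M A = Z A * a" "M B = Z B * b" using pos by (auto simp: a_def b_def)
  have U: "Z (A \<union> B) = Z A + Z B" "M (A \<union> B) = M A + M B"
    unfolding Z_def M_def using fin disj by (auto simp: sum.union_disjoint)
  have "ent (A \<union> B) w F - ent A w F - ent B w F =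
     Z A * a * ln a + Z B * b * ln b - (Z A * a + Z B * b) * ln ((Z A * a + Z B * b) / (Z A + Z B))"
  proof -
    have "(\<Sum>S\<in>A \<union> B. w S * (F S * ln (F S))) = (\<Sum>S\<in>A. w S * (F S * ln (F S))) + (\<Sum>S\<in>B. w S * (F S * ln (F S)))"
      using fin disj by (simp add: sum.union_disjoint)
    then have "ent (A \<union> B) w F - ent A w F - ent B w F =
      M A * ln (M A / Z A) + M B * ln (M B / Z B) - (M A + M B) * ln ((M A + M B) / (Z A + Z B))"
      unfolding ent_def Z_def[symmetric] M_def[symmetric] U by simp
    also have "M A / Z A = a" by (simp add: a_def)
    also have "M B / Z B = b" by (simp add: b_def)
    finally show ?thesis by (simp only: Mab)
  qed
  also have "\<dots> \<le> Z A * Z B / (Z A + Z B) * psi a b"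
    by (rule two_point_ent) (use pos ab in auto)
  also have "Z A * Z B * psi a b = psi (Z B * M A) (Z A * M B)"
    using psi_scale[of "Z A * Z B" a b] pos ab by (simp add: Mab mult_ac)
  then have "Z A * Z B / (Z A + Z B) * psi a b = psi (Z B * M A) (Z A * M B) / Z (A \<union> B)"
    by (simp add: U)
  finally show ?thesis by simp
qed


section \<open>A modified logarithmic Sobolev inequality on slices\<close>

text \<open>Coordinates in \<open>P\<close> are pinned to one, those in \<open>V\<close> are free and all others are zero.\<close>
definition slice :: "'a set \<Rightarrow> 'a set \<Rightarrow> nat \<Rightarrow> 'a set set" where
  "slice P V k = {S. P \<subseteq> S \<and> S \<subseteq> P \<union> V \<and> card S = k}"

definition swap :: "'a \<Rightarrow> 'a \<Rightarrow> 'a set \<Rightarrow> 'a set" where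
  "swap i j S = insert j (S - {i})"

text \<open>Mass of a triple \<open>(S, X, i)\<close> when \<open>S\<close>, \<open>X\<close> are drawn independently and then \<open>i\<close> uniformly from
  \<open>S - X\<close>; meaningful only for \<open>S - X \<noteq> {}\<close>.\<close>
definition coup :: "('a \<Rightarrow> real) \<Rightarrow> 'a set \<Rightarrow> 'a set \<Rightarrow> real" where
  "coup w S X = prod w S * prod w X / real (card (S - X))"

lemma finite_slice [simp]: "finite P \<Longrightarrow> finite V \<Longrightarrow> finite (slice P V k)"
  by (rule finite_subset[of _ "Pow (P \<union> V)"]) (auto simp: slice_def)

lemma slice_finite: "S \<in> slice P V k \<Longrightarrow> finite P \<Longrightarrow> finite V \<Longrightarrow> finite S"
  unfolding slice_def by (auto intro: finite_subset[of _ "P \<union> V"])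

lemma slice_diff_subset: "S \<in> slice P V k \<Longrightarrow> X \<in> slice P V k \<Longrightarrow> S - X \<subseteq> V"
  by (auto simp: slice_def)

lemma card_Diff_sym:
  assumes "finite S" "finite X" "card S = card X"
  shows "card (S - X) = card (X - S)"
  using assms by (simp add: card_Diff_subset_Int Int_commute)

lemma swap_slice:
  assumes "S \<in> slice P V k" "X \<in> slice P V k" "i \<in> S - X" "j \<in> X - S" "finite P" "finite V"
  shows "swap i j S \<in> slice P V k"
proof -
  have "finite S" using assms slice_finite by blast
  moreover have "card S > 0" using assms \<open>finite S\<close> by (auto simp: card_gt_0_iff)
  ultimately have "card (swap i j S) = card S"
    using assms by (simp add: swap_def)
  then show ?thesis using assms by (auto simp: slice_def swap_def)
qed

lemma swap_swap: "i \<in> S \<Longrightarrow> j \<notin> S \<Longrightarrow> swap j i (swap i j S) = S"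
  by (auto simp: swap_def)

text \<open>The exchange trades the factors \<open>w i\<close> and \<open>w j\<close> between the
  two products, and \<open>S - X\<close> merely has \<open>i\<close> replaced by \<open>j\<close>,
  so its size stays the same. This is the reversibility behind both reindexings below.\<close>

lemma coup_swap:
  assumes "finite S" "finite X" "i \<in> S - X" "j \<in> X - S"
  shows "coup w (swap i j S) (swap j i X) = coup w S X"
proof -
  have 1: "prod w (swap i j S) = w j * prod w (S - {i})" "prod w (swap j i X) = w i * prod w (X - {j})"
    using assms by (auto simp: swap_def)
  have 2: "prod w S = w i * prod w (S - {i})" "prod w X = w j * prod w (X - {j})"
    using assms by (auto simp: prod.remove)
  have "swap i j S - swap j i X = insert j (S - X - {i})"
    using assms by (auto simp: swap_def)
  moreover have "card (S - X) > 0" using assms by (auto simp: card_gt_0_iff)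
  ultimately have "card (swap i j S - swap j i X) = card (S - X)"
    using assms by simp
  then show ?thesis by (simp add: coup_def 1 2 mult_ac)
qed

lemma coup_mult_card:
  assumes "finite S" "S - X \<noteq> {}"
  shows "coup w S X * real (card (S - X)) = prod w S * prod w X"
  using assms by (simp add: coup_def)

lemma sum_Sigma3:
  assumes "finite A" "\<And>x. x \<in> A \<Longrightarrow> finite (B x)" "\<And>x y. x \<in> A \<Longrightarrow> y \<in> B x \<Longrightarrow> finite (C x y)"
  shows "(\<Sum>x\<in>A. \<Sum>y\<in>B x. \<Sum>z\<in>C x y. g x y z)
     = (\<Sum>(x, y, z)\<in>(SIGMA x:A. SIGMA y:B x. C x y). g x y z)"
  using assms by (simp add: sum.Sigma)

text \<open>Both cross products become integrals over the same triples \<open>(S, X, i)\<close>, of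
  \<open>F S\<close> and of \<open>F (swap i j S)\<close>. Subadditivity and homogeneity of
  \<open>psi\<close> then finish.\<close>

lemma coupling_ineq:
  fixes F :: "'a set \<Rightarrow> real" and j :: 'a
  defines "A \<equiv> \<lambda>P V k. {S \<in> slice P V k. j \<notin> S}" and "B \<equiv> \<lambda>P V k. {S \<in> slice P V k. j \<in> S}"
  assumes fin: "finite P" "finite V" and w: "\<And>i. i \<in> P \<union> V \<Longrightarrow> 0 < w i" and F: "\<And>S. 0 < F S"
  shows "psi ((\<Sum>S\<in>B P V k. prod w S) * (\<Sum>S\<in>A P V k. prod w S * F S))
             ((\<Sum>S\<in>A P V k. prod w S) * (\<Sum>S\<in>B P V k. prod w S * F S))
    \<le> (\<Sum>S\<in>A P V k. \<Sum>X\<in>B P V k. \<Sum>i\<in>S - X. coup w S X * psi (F S) (F (swap i j S)))"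
proof -
  define A' B' where "A' = A P V k" and "B' = B P V k"
  have fAB: "finite A'" "finite B'" using fin by (auto simp: A'_def B'_def A_def B_def)
  have fS: "finite S" "card S = k" if "S \<in> A' \<union> B'" for S
    using that fin slice_finite by (auto simp: A'_def B'_def A_def B_def slice_def)
  have pw: "prod w S > 0" if "S \<in> A' \<union> B'" for S
    using that w by (intro prod_pos) (auto simp: A'_def B'_def A_def B_def slice_def)
  \<comment> \<open>Here \<open>j\<close> separates \<open>X\<close> from \<open>S\<close>, and
    equal cardinalities make \<open>S - X\<close> nonempty as well, so \<open>coup\<close> divides
    by a positive number.\<close>
  have ne: "S - X \<noteq> {}" "X - S \<noteq> {}" "card (S - X) = card (X - S)" if "S \<in> A'" "X \<in> B'" for S X
  proof -
    show e: "card (S - X) = card (X - S)" using that fS by (intro card_Diff_sym) auto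
    show "X - S \<noteq> {}" using that by (auto simp: A'_def B'_def A_def B_def)
    then show "S - X \<noteq> {}" using e that fS by (metis UnI2 card_0_eq card.empty finite_Diff)
  qed
  have cp: "coup w S X > 0" if "S \<in> A'" "X \<in> B'" for S X
    using that ne fS pw by (auto simp: coup_def card_gt_0_iff intro!: divide_pos_pos mult_pos_pos)
  define T where "T = (SIGMA S:A'. SIGMA X:B'. S - X)"
  define T' where "T' = (SIGMA S:B'. SIGMA X:A'. X - S)"
  have fT: "finite T" using fAB fS by (auto simp: T_def intro!: finite_SigmaI)
  have 1: "(\<Sum>S\<in>B'. prod w S) * (\<Sum>S\<in>A'. prod w S * F S) = (\<Sum>(S,X,i)\<in>T. coup w S X * F S)"
  proof -
    have "(\<Sum>S\<in>B'. prod w S) * (\<Sum>S\<in>A'. prod w S * F S) = (\<Sum>S\<in>A'. \<Sum>X\<in>B'. prod w S * prod w X * F S)"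
      unfolding sum_product by (subst sum.swap) (simp add: mult_ac)
    also have "\<dots> = (\<Sum>S\<in>A'. \<Sum>X\<in>B'. \<Sum>i\<in>S - X. coup w S X * F S)"
      using ne fS by (intro sum.cong refl) (simp add: coup_mult_card [symmetric])
    finally show ?thesis unfolding T_def
      using fAB fS by (subst (asm) sum_Sigma3) auto
  qed
  have 2: "(\<Sum>S\<in>A'. prod w S) * (\<Sum>S\<in>B'. prod w S * F S) = (\<Sum>(S,X,i)\<in>T. coup w S X * F (swap i j S))"
  proof -
    have "(\<Sum>S\<in>A'. prod w S) * (\<Sum>S\<in>B'. prod w S * F S) = (\<Sum>S\<in>B'. \<Sum>X\<in>A'. prod w S * prod w X * F S)"
      unfolding sum_product by (subst sum.swap) (simp add: mult_ac)
    also have "\<dots> = (\<Sum>S\<in>B'. \<Sum>X\<in>A'. \<Sum>i\<in>X - S. coup w S X * F S)"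
    proof (intro sum.cong refl)
      fix S X assume SX: "S \<in> B'" "X \<in> A'"
      have "coup w S X * real (card (X - S)) = prod w S * prod w X"
        using coup_mult_card[of S X w] ne[OF SX(2,1)] fS SX by simp
      then have e: "prod w S * prod w X = coup w S X * real (card (X - S))" by simp
      show "prod w S * prod w X * F S = (\<Sum>i\<in>X - S. coup w S X * F S)" unfolding e by simp
    qed
    also have "\<dots> = (\<Sum>(S,X,i)\<in>T'. coup w S X * F S)"
      unfolding T'_def using fAB fS by (subst sum_Sigma3) auto
    \<comment> \<open>In \<open>T'\<close> the set \<open>S\<close> contains \<open>j\<close> and
      \<open>X\<close> does not. Exchanging \<open>j\<close> and \<open>i\<close> between them
      reverses these roles, preserves \<open>coup\<close>, and makes the old \<open>S\<close> equal
      to \<open>swap i j\<close> of the new one.\<close>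
    also have "\<dots> = (\<Sum>(S,X,i)\<in>T. coup w S X * F (swap i j S))"
    proof (rule sum.reindex_bij_witness[where
          i = "\<lambda>(S,X,i). (swap i j S, swap j i X, i)" and j = "\<lambda>(S,X,i). (swap j i S, swap i j X, i)"], goal_cases)
      case (1 t)
      then show ?case by (auto simp: T'_def A'_def B'_def A_def B_def swap_swap)
    next
      case (2 t)
      obtain S X i where t: "t = (S, X, i)" by (cases t)
      then have *: "S \<in> slice P V k" "X \<in> slice P V k" "j \<in> S - X" "i \<in> X - S"
        using 2 by (auto simp: T'_def A'_def B'_def A_def B_def)
      then have "swap j i S \<in> slice P V k" "swap i j X \<in> slice P V k" using fin by (auto intro: swap_slice[of S P V k X] swap_slice[of X P V k S])
      then show ?case using * by (auto simp: t T_def T'_def A'_def B'_def A_def B_def swap_def)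
    next
      case (3 t)
      then show ?case by (auto simp: T_def A'_def B'_def A_def B_def swap_swap)
    next
      case (4 t)
      obtain S X i where t: "t = (S, X, i)" by (cases t)
      then have *: "S \<in> slice P V k" "X \<in> slice P V k" "i \<in> S - X" "j \<in> X - S"
        using 4 by (auto simp: T_def A'_def B'_def A_def B_def)
      then have "swap i j S \<in> slice P V k" "swap j i X \<in> slice P V k" using fin by (auto intro: swap_slice[of S P V k X] swap_slice[of X P V k S])
      then show ?case using * by (auto simp: t T_def T'_def A'_def B'_def A_def B_def swap_def)
    next
      case (5 t)
      obtain S X i where t: "t = (S, X, i)" by (cases t)
      have "finite S" "finite X" "j \<in> S - X" "i \<in> X - S"
        using 5 fS by (auto simp: t T'_def A'_def B'_def A_def B_def)
      then show ?case by (simp add: t coup_swap swap_swap)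
    qed
    finally show ?thesis .
  qed
  have "psi (\<Sum>(S,X,i)\<in>T. coup w S X * F S) (\<Sum>(S,X,i)\<in>T. coup w S X * F (swap i j S))
     \<le> (\<Sum>t\<in>T. psi ((\<lambda>(S,X,i). coup w S X * F S) t) ((\<lambda>(S,X,i). coup w S X * F (swap i j S)) t))"
    by (rule psi_sum) (use fT F cp in \<open>auto simp: T_def\<close>)
  also have "\<dots> = (\<Sum>(S,X,i)\<in>T. coup w S X * psi (F S) (F (swap i j S)))"
    using F cp by (intro sum.cong refl) (auto simp: T_def intro!: psi_scale)
  also have "\<dots> = (\<Sum>S\<in>A'. \<Sum>X\<in>B'. \<Sum>i\<in>S - X. coup w S X * psi (F S) (F (swap i j S)))"
    unfolding T_def using fAB fS by (subst sum_Sigma3) auto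
  finally show ?thesis unfolding 1[symmetric] 2[symmetric] unfolding A'_def B'_def .
qed


text \<open>Performing the exchange in \<open>S\<close> and \<open>X\<close> and interchanging the
  names \<open>i\<close> and \<open>j\<close> is an involution on the index set that preserves
  \<open>coup\<close>. It carries terms at the end point of a move back to its starting
  point.\<close>

lemma coupling_symmetrize:
  fixes h :: "'a set \<Rightarrow> 'a \<Rightarrow> real"
  assumes fin: "finite P" "finite V"
  shows "(\<Sum>S\<in>slice P V k. \<Sum>X\<in>slice P V k. \<Sum>i\<in>S - X. \<Sum>j\<in>X - S.
            coup w S X * (h (swap i j S) i + h (swap i j S) j))
       = (\<Sum>S\<in>slice P V k. \<Sum>X\<in>slice P V k. \<Sum>i\<in>S - X. \<Sum>j\<in>X - S. coup w S X * (h S i + h S j))"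
proof -
  let ?\<Omega> = "slice P V k"
  define T where "T = (SIGMA S:?\<Omega>. SIGMA X:?\<Omega>. (S - X) \<times> (X - S))"
  have fS: "finite S" if "S \<in> ?\<Omega>" for S using that fin slice_finite by blast
  have T: "(\<Sum>S\<in>?\<Omega>. \<Sum>X\<in>?\<Omega>. \<Sum>i\<in>S - X. \<Sum>j\<in>X - S. g S X i j) = (\<Sum>(S,X,i,j)\<in>T. g S X i j)"
    for g :: "'a set \<Rightarrow> 'a set \<Rightarrow> 'a \<Rightarrow> 'a \<Rightarrow> real"
    using sum_Sigma3[of ?\<Omega> "\<lambda>_. ?\<Omega>" "\<lambda>S X. (S - X) \<times> (X - S)" "\<lambda>S X (i,j). g S X i j"] fin fS
    by (simp add: T_def sum.cartesian_product)
  show ?thesis unfolding T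
  proof (rule sum.reindex_bij_witness[where
        i = "\<lambda>(S,X,i,j). (swap i j S, swap j i X, j, i)" and j = "\<lambda>(S,X,i,j). (swap i j S, swap j i X, j, i)"], goal_cases)
    case (1 t)
    then show ?case by (auto simp: T_def swap_swap)
  next
    case (2 t)
    obtain S X i j where t: "t = (S, X, i, j)" by (cases t)
    then have *: "S \<in> ?\<Omega>" "X \<in> ?\<Omega>" "i \<in> S - X" "j \<in> X - S" using 2 by (auto simp: T_def)
    then have "swap i j S \<in> ?\<Omega>" "swap j i X \<in> ?\<Omega>" using fin by (auto intro: swap_slice[of S P V k X] swap_slice[of X P V k S])
    then show ?case using * by (auto simp: t T_def swap_def)
  next
    case (3 t)
    then show ?case by (auto simp: T_def swap_swap)
  next
    case (4 t)
    obtain S X i j where t: "t = (S, X, i, j)" by (cases t)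
    then have *: "S \<in> ?\<Omega>" "X \<in> ?\<Omega>" "i \<in> S - X" "j \<in> X - S" using 4 by (auto simp: T_def)
    then have "swap i j S \<in> ?\<Omega>" "swap j i X \<in> ?\<Omega>" using fin by (auto intro: swap_slice[of S P V k X] swap_slice[of X P V k S])
    then show ?case using * by (auto simp: t T_def swap_def)
  next
    case (5 t)
    obtain S X i j where t: "t = (S, X, i, j)" by (cases t)
    have "finite S" "finite X" "i \<in> S - X" "j \<in> X - S"
      using 5 fS by (auto simp: t T_def)
    then show ?case by (simp add: t coup_swap swap_swap)
  qed
qed

text \<open>Moving a uniformly random element of the difference of two configurations towards the
  other one touches each coordinate at rate at most one.\<close>
lemma coupling_site_rate:
  fixes h :: "'a set \<Rightarrow> 'a \<Rightarrow> real"
  assumes fin: "finite P" "finite V" and w: "\<And>i. i \<in> P \<union> V \<Longrightarrow> 0 < w i" and h: "\<And>S i. 0 \<le> h S i"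
  shows "(\<Sum>S\<in>slice P V k. \<Sum>X\<in>slice P V k. \<Sum>i\<in>S - X. \<Sum>j\<in>X - S. coup w S X * (h S i + h S j))
     \<le> (\<Sum>X\<in>slice P V k. prod w X) * (\<Sum>S\<in>slice P V k. prod w S * (\<Sum>i\<in>V. h S i))"
proof -
  let ?\<Omega> = "slice P V k"
  have fS: "finite S" "card S = k" if "S \<in> ?\<Omega>" for S
    using that fin slice_finite by (blast, simp add: slice_def)
  have pw: "prod w S > 0" if "S \<in> ?\<Omega>" for S
    using that w by (intro prod_pos) (auto simp: slice_def)
  have "(\<Sum>i\<in>S - X. \<Sum>j\<in>X - S. coup w S X * (h S i + h S j)) \<le> prod w X * (prod w S * (\<Sum>i\<in>V. h S i))"
    if "S \<in> ?\<Omega>" "X \<in> ?\<Omega>" for S X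
  proof (cases "S - X = {}")
    case True
    have "0 \<le> prod w X * (prod w S * (\<Sum>i\<in>V. h S i))"
      using pw that h by (intro mult_nonneg_nonneg sum_nonneg) (auto simp: less_imp_le)
    then show ?thesis by (simp only: True sum.empty)
  next
    case False
    have c: "card (X - S) = card (S - X)"
      using that fS by (intro card_Diff_sym) auto
    \<comment> \<open>Each term \<open>h S i\<close> or \<open>h S j\<close> is repeated once per
      element of the opposite difference. Both differences have the same size, and this factor
      cancels the denominator of \<open>coup\<close>.\<close>
    have "(\<Sum>i\<in>S - X. \<Sum>j\<in>X - S. coup w S X * (h S i + h S j))
       = coup w S X * real (card (S - X)) * ((\<Sum>i\<in>S - X. h S i) + (\<Sum>j\<in>X - S. h S j))"
    proof -
      have "(\<Sum>i\<in>S - X. \<Sum>j\<in>X - S. h S i + h S j)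
        = real (card (S - X)) * ((\<Sum>i\<in>S - X. h S i) + (\<Sum>j\<in>X - S. h S j))"
        by (simp add: sum.distrib sum_distrib_left c distrib_left)
      then show ?thesis by (simp only: sum_distrib_left [symmetric] mult.assoc)
    qed
    also have "(\<Sum>i\<in>S - X. h S i) + (\<Sum>j\<in>X - S. h S j) = (\<Sum>i\<in>(S - X) \<union> (X - S). h S i)"
      using that fS by (intro sum.union_disjoint [symmetric]) auto
    also have "coup w S X * real (card (S - X)) = prod w S * prod w X"
      using False fS that by (intro coup_mult_card) auto
    also have "(\<Sum>i\<in>(S - X) \<union> (X - S). h S i) \<le> (\<Sum>i\<in>V. h S i)"
      using fin h slice_diff_subset[OF that] slice_diff_subset[OF that(2,1)] by (intro sum_mono2) auto
    finally show ?thesis using pw that by (simp add: mult_ac)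
  qed
  then have "(\<Sum>S\<in>?\<Omega>. \<Sum>X\<in>?\<Omega>. \<Sum>i\<in>S - X. \<Sum>j\<in>X - S. coup w S X * (h S i + h S j))
    \<le> (\<Sum>S\<in>?\<Omega>. \<Sum>X\<in>?\<Omega>. prod w X * (prod w S * (\<Sum>i\<in>V. h S i)))"
    by (intro sum_mono)
  then show ?thesis unfolding sum_product by (subst (2) sum.swap)
qed

text \<open>Reveal a uniformly random coordinate \<open>j \<in> V\<close>. Summed over \<open>j\<close>, the two-point terms are
  controlled by \<open>coupling_ineq\<close> and contribute at most twice the right-hand sum, while each \<open>h S i\<close>
  survives in \<open>card V - 1\<close> of the conditional entropies; hence the constant 2 reproduces itself.\<close>
lemma modified_log_sobolev_slice:
  fixes F :: "'a set \<Rightarrow> real" and h :: "'a set \<Rightarrow> 'a \<Rightarrow> real"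
  assumes "finite P" "finite V" "P \<inter> V = {}" and "\<And>i. i \<in> P \<union> V \<Longrightarrow> 0 < w i"
    and F: "\<And>S. 0 < F S" and h: "\<And>S i. 0 \<le> h S i"
    and Fh: "\<And>S i j. S \<subseteq> P \<union> V \<Longrightarrow> card S = k \<Longrightarrow> i \<in> S \<Longrightarrow> j \<in> P \<union> V \<Longrightarrow> j \<notin> S \<Longrightarrow>
      psi (F S) (F (swap i j S)) \<le> h S i + h S j + h (swap i j S) i + h (swap i j S) j"
  shows "ent (slice P V k) (prod w) F \<le> 2 * (\<Sum>S\<in>slice P V k. prod w S * (\<Sum>i\<in>V. h S i))"
  using assms(1-4,7)
proof (induction "card V" arbitrary: P V)
  case 0
  then have "slice P V k \<subseteq> {P}" by (auto simp: slice_def)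
  then consider "slice P V k = {}" | "slice P V k = {P}" by blast
  then have "ent (slice P V k) (prod w) F = 0"
  proof cases
    case 2
    have "prod w P > 0" using 0 by (intro prod_pos) auto
    then show ?thesis using 2 by (simp add: ent_def)
  qed (simp add: ent_def)
  then show ?case using 0 by simp
next
  case (Suc m)
  note fin = Suc.prems(1,2) and w = Suc.prems(4)
  let ?\<Omega> = "slice P V k"
  define Z where "Z = (\<Sum>S\<in>?\<Omega>. prod w S)"
  define R where "R = (\<Sum>S\<in>?\<Omega>. prod w S * (\<Sum>i\<in>V. h S i))"
  define G where "G = (\<lambda>S. \<lambda>X. \<lambda>i. \<lambda>j. coup w S X * psi (F S) (F (swap i j S)))"
  have pw: "prod w S > 0" if "S \<in> ?\<Omega>" for S
    using that w by (intro prod_pos) (auto simp: slice_def)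
  have Z0: "Z \<ge> 0" unfolding Z_def using pw by (intro sum_nonneg) (auto simp: less_imp_le)
  have fS: "finite S" "card S = k" if "S \<in> ?\<Omega>" for S
    using that fin slice_finite by (blast, simp add: slice_def)
  have step: "ent ?\<Omega> (prod w) F \<le> 2 * (\<Sum>S\<in>?\<Omega>. prod w S * (\<Sum>i\<in>V - {j}. h S i))
      + (\<Sum>S\<in>{S \<in> ?\<Omega>. j \<notin> S}. \<Sum>X\<in>{S \<in> ?\<Omega>. j \<in> S}. \<Sum>i\<in>S - X. G S X i j) / Z" if j: "j \<in> V" for j
  proof -
    let ?A = "{S \<in> ?\<Omega>. j \<notin> S}" and ?B = "{S \<in> ?\<Omega>. j \<in> S}"
    \<comment> \<open>Revealing \<open>j\<close> as zero drops it from the free set; revealing it as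
      one also pins it. Both conditional laws live on slices with \<open>m\<close> free coordinates,
      so the induction hypothesis covers them.\<close>
    have A: "?A = slice P (V - {j}) k" and B: "?B = slice (insert j P) (V - {j}) k"
      using j Suc.prems(3) by (auto simp: slice_def)
    have U: "?\<Omega> = ?A \<union> ?B" by auto
    have cV: "m = card (V - {j})" using Suc.hyps(2) fin j by simp
    have "ent ?A (prod w) F \<le> 2 * (\<Sum>S\<in>?A. prod w S * (\<Sum>i\<in>V - {j}. h S i))"
      unfolding A
    proof (rule Suc.hyps(1)[OF cV], goal_cases)
      case (5 S i l)
      then show ?case using j by (intro Suc.prems(5)) auto
    qed (use fin w j Suc.prems(3) in auto)
    moreover have "ent ?B (prod w) F \<le> 2 * (\<Sum>S\<in>?B. prod w S * (\<Sum>i\<in>V - {j}. h S i))"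
      unfolding B
    proof (rule Suc.hyps(1)[OF cV], goal_cases)
      case (5 S i l)
      then show ?case using j by (intro Suc.prems(5)) auto
    qed (use fin w j Suc.prems(3) in auto)
    moreover have "(\<Sum>S\<in>?\<Omega>. prod w S * (\<Sum>i\<in>V - {j}. h S i))
       = (\<Sum>S\<in>?A. prod w S * (\<Sum>i\<in>V - {j}. h S i)) + (\<Sum>S\<in>?B. prod w S * (\<Sum>i\<in>V - {j}. h S i))"
      by (subst U, rule sum.union_disjoint) (use fin in auto)
    moreover have "ent (?A \<union> ?B) (prod w) F \<le> ent ?A (prod w) F + ent ?B (prod w) F
       + psi (sum (prod w) ?B * (\<Sum>S\<in>?A. prod w S * F S)) (sum (prod w) ?A * (\<Sum>S\<in>?B. prod w S * F S))
          / sum (prod w) (?A \<union> ?B)"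
      using fin pw F by (intro ent_Un_le) auto
    moreover have "psi (sum (prod w) ?B * (\<Sum>S\<in>?A. prod w S * F S)) (sum (prod w) ?A * (\<Sum>S\<in>?B. prod w S * F S)) / Z
       \<le> (\<Sum>S\<in>?A. \<Sum>X\<in>?B. \<Sum>i\<in>S - X. G S X i j) / Z"
      unfolding G_def using Z0 fin w F by (intro divide_right_mono coupling_ineq) auto
    ultimately show ?thesis
      unfolding U[symmetric] Z_def[symmetric] by simp
  qed
  have "real (Suc m) * ent ?\<Omega> (prod w) F = (\<Sum>j\<in>V. ent ?\<Omega> (prod w) F)"
    using Suc.hyps(2) by simp
  also have "\<dots> \<le> (\<Sum>j\<in>V. 2 * (\<Sum>S\<in>?\<Omega>. prod w S * (\<Sum>i\<in>V - {j}. h S i))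
      + (\<Sum>S\<in>{S \<in> ?\<Omega>. j \<notin> S}. \<Sum>X\<in>{S \<in> ?\<Omega>. j \<in> S}. \<Sum>i\<in>S - X. G S X i j) / Z)"
    by (intro sum_mono step)
  also have "\<dots> = 2 * (\<Sum>j\<in>V. \<Sum>S\<in>?\<Omega>. prod w S * (\<Sum>i\<in>V - {j}. h S i))
      + (\<Sum>j\<in>V. \<Sum>S\<in>{S \<in> ?\<Omega>. j \<notin> S}. \<Sum>X\<in>{S \<in> ?\<Omega>. j \<in> S}. \<Sum>i\<in>S - X. G S X i j) / Z"
    by (simp add: sum.distrib sum_distrib_left sum_divide_distrib)
  also have "(\<Sum>j\<in>V. \<Sum>S\<in>?\<Omega>. prod w S * (\<Sum>i\<in>V - {j}. h S i)) = real m * R"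
  proof -
    have "(\<Sum>j\<in>V. \<Sum>i\<in>V - {j}. h S i) = real m * (\<Sum>i\<in>V. h S i)" for S
    proof -
      have "(\<Sum>j\<in>V. \<Sum>i\<in>V - {j}. h S i) = (\<Sum>j\<in>V. (\<Sum>i\<in>V. h S i) - h S j)"
        using fin by (intro sum.cong refl) (simp add: sum_diff1)
      also have "\<dots> = real m * (\<Sum>i\<in>V. h S i)"
        using Suc.hyps(2) [symmetric] by (simp add: sum_subtractf algebra_simps)
      finally show ?thesis .
    qed
    then have "(\<Sum>S\<in>?\<Omega>. prod w S * (\<Sum>j\<in>V. \<Sum>i\<in>V - {j}. h S i)) = real m * R"
      by (simp add: R_def sum_distrib_left mult.left_commute)
    then show ?thesis
      by (subst sum.swap) (simp only: sum_distrib_left [symmetric])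
  qed
  \<comment> \<open>A pair contributes for \<open>j\<close> exactly when
    \<open>j \<in> X - S\<close>, and such a \<open>j\<close> is always free. The sum over
    \<open>j\<close> can therefore be moved inside the sum over pairs.\<close>
  also have "(\<Sum>j\<in>V. \<Sum>S\<in>{S \<in> ?\<Omega>. j \<notin> S}. \<Sum>X\<in>{S \<in> ?\<Omega>. j \<in> S}. \<Sum>i\<in>S - X. G S X i j)
      = (\<Sum>S\<in>?\<Omega>. \<Sum>X\<in>?\<Omega>. \<Sum>i\<in>S - X. \<Sum>j\<in>X - S. G S X i j)"
  proof -
    have "(\<Sum>j\<in>V. \<Sum>S\<in>{S \<in> ?\<Omega>. j \<notin> S}. \<Sum>X\<in>{S \<in> ?\<Omega>. j \<in> S}. \<Sum>i\<in>S - X. G S X i j)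
      = (\<Sum>j\<in>V. \<Sum>S\<in>?\<Omega>. \<Sum>X\<in>?\<Omega>. if j \<in> X - S then \<Sum>i\<in>S - X. G S X i j else 0)"
      unfolding sum.inter_filter [OF finite_slice [OF fin]]
      by (intro sum.cong refl) (auto intro!: sum.cong)
    also have "\<dots> = (\<Sum>S\<in>?\<Omega>. \<Sum>j\<in>V. \<Sum>X\<in>?\<Omega>. if j \<in> X - S then \<Sum>i\<in>S - X. G S X i j else 0)"
      by (rule sum.swap)
    also have "\<dots> = (\<Sum>S\<in>?\<Omega>. \<Sum>X\<in>?\<Omega>. \<Sum>j\<in>V. if j \<in> X - S then \<Sum>i\<in>S - X. G S X i j else 0)"
      by (rule sum.cong [OF refl], rule sum.swap)
    also have "\<dots> = (\<Sum>S\<in>?\<Omega>. \<Sum>X\<in>?\<Omega>. \<Sum>i\<in>S - X. \<Sum>j\<in>X - S. G S X i j)"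
    proof (rule sum.cong [OF refl], rule sum.cong [OF refl])
      fix S X assume SX: "S \<in> ?\<Omega>" "X \<in> ?\<Omega>"
      have "(\<Sum>j\<in>V. if j \<in> X - S then \<Sum>i\<in>S - X. G S X i j else 0) = (\<Sum>j\<in>X - S. \<Sum>i\<in>S - X. G S X i j)"
        using fin slice_diff_subset[OF SX(2,1)] by (subst sum.inter_restrict [symmetric]) (auto intro!: sum.cong)
      also have "\<dots> = (\<Sum>i\<in>S - X. \<Sum>j\<in>X - S. G S X i j)" by (rule sum.swap)
      finally show "(\<Sum>j\<in>V. if j \<in> X - S then \<Sum>i\<in>S - X. G S X i j else 0) = (\<Sum>i\<in>S - X. \<Sum>j\<in>X - S. G S X i j)" .
    qed
    finally show ?thesis .
  qed
  also have "(\<Sum>S\<in>?\<Omega>. \<Sum>X\<in>?\<Omega>. \<Sum>i\<in>S - X. \<Sum>j\<in>X - S. G S X i j) \<le> 2 * (Z * R)"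
  proof -
    have "(\<Sum>S\<in>?\<Omega>. \<Sum>X\<in>?\<Omega>. \<Sum>i\<in>S - X. \<Sum>j\<in>X - S. G S X i j)
      \<le> (\<Sum>S\<in>?\<Omega>. \<Sum>X\<in>?\<Omega>. \<Sum>i\<in>S - X. \<Sum>j\<in>X - S. coup w S X * (h S i + h S j)
          + coup w S X * (h (swap i j S) i + h (swap i j S) j))"
    proof (intro sum_mono)
      fix S X i j assume *: "S \<in> ?\<Omega>" "X \<in> ?\<Omega>" "i \<in> S - X" "j \<in> X - S"
      have "psi (F S) (F (swap i j S)) \<le> h S i + h S j + h (swap i j S) i + h (swap i j S) j"
        using * by (intro Suc.prems(5)) (auto simp: slice_def)
      moreover have "coup w S X \<ge> 0" using * pw by (simp add: coup_def less_imp_le)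
      ultimately have "G S X i j \<le> coup w S X * (h S i + h S j + h (swap i j S) i + h (swap i j S) j)"
        unfolding G_def by (rule mult_left_mono)
      then show "G S X i j \<le> coup w S X * (h S i + h S j) + coup w S X * (h (swap i j S) i + h (swap i j S) j)"
        by (simp add: algebra_simps)
    qed
    \<comment> \<open>By reversibility the terms at the swapped configuration contribute as much as
      those at \<open>S\<close>.\<close>
    also have "\<dots> = 2 * (\<Sum>S\<in>?\<Omega>. \<Sum>X\<in>?\<Omega>. \<Sum>i\<in>S - X. \<Sum>j\<in>X - S. coup w S X * (h S i + h S j))"
      unfolding sum.distrib coupling_symmetrize[OF fin] by simp
    also have "\<dots> \<le> 2 * (Z * R)"
      unfolding Z_def R_def using fin w h by (intro mult_left_mono coupling_site_rate) auto
    finally show ?thesis .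
  qed
  finally have "real (Suc m) * ent ?\<Omega> (prod w) F \<le> 2 * (real m * R) + 2 * (Z * R) / Z"
    using Z0 by (simp add: divide_right_mono)
  \<comment> \<open>Only an inequality: for an empty slice \<open>Z\<close> is 0, the quotient
    defaults to 0, and nonnegativity of \<open>R\<close> is what counts.\<close>
  moreover have "2 * (Z * R) / Z \<le> 2 * R"
  proof -
    have "R \<ge> 0" unfolding R_def using pw h by (intro sum_nonneg mult_nonneg_nonneg) (auto simp: less_imp_le)
    then show ?thesis by simp
  qed
  ultimately have "real (Suc m) * ent ?\<Omega> (prod w) F \<le> real (Suc m) * (2 * R)"
    by (simp add: algebra_simps)
  then show ?case unfolding R_def [symmetric] by (simp only: mult_le_cancel_left_pos of_nat_0_less_iff zero_less_Suc)
qed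

section \<open>The Herbst argument\<close>

text \<open>Divided by \<open>Z t * t^2\<close>, the hypothesis says that ln Z(t) / t - K ln Z(t)
  has nonpositive derivative away from 0. Its limit at 0 from either side is the mean of
  \<open>f\<close>, so its value at \<open>l\<close> is at most its value at \<open>- s\<close>,
  which rearranges to the claim.\<close>

lemma herbst_two_sided:
  fixes D :: "'b set" and w f :: "'b \<Rightarrow> real" and K s l :: real
  defines "Z \<equiv> \<lambda>t. \<Sum>S\<in>D. w S * exp (t * f S)" and "M \<equiv> \<lambda>t. \<Sum>S\<in>D. w S * (f S * exp (t * f S))"
  assumes D: "finite D" "\<And>S. S \<in> D \<Longrightarrow> 0 < w S" "sum w D = 1"
    and s: "0 < s" and l: "0 < l"
    and ent: "\<And>t. - s \<le> t \<Longrightarrow> t \<le> l \<Longrightarrow> t * M t - Z t * ln (Z t) \<le> K * t\<^sup>2 * M t"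
  shows "(1 / l - K) * ln (Z l) + (1 / s + K) * ln (Z (- s)) \<le> 0"
proof -
  have "D \<noteq> {}" using D by auto
  then have Zpos: "Z t > 0" for t unfolding Z_def using D by (intro sum_pos) auto
  define L where "L = (\<lambda>t. ln (Z t))"
  define R where "R = (\<lambda>t. L t / t - K * L t)"
  have Z0: "Z 0 = 1" "L 0 = 0" using D by (simp_all add: Z_def L_def)
  have dZ: "(Z has_real_derivative M t) (at t)" for t
    unfolding Z_def M_def by (auto intro!: derivative_eq_intros sum.cong simp: algebra_simps)
  have dL: "(L has_real_derivative M t / Z t) (at t)" for t
    unfolding L_def using Zpos[of t] by (auto intro!: derivative_eq_intros dZ)
  have dR: "\<exists>y. (R has_real_derivative y) (at t) \<and> y \<le> 0" if t: "- s \<le> t" "t \<le> l" "t \<noteq> 0" for t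
  proof (intro exI conjI)
    show "(R has_real_derivative (M t / Z t * t - L t) / t\<^sup>2 - K * (M t / Z t)) (at t)"
      unfolding R_def using t by (auto intro!: derivative_eq_intros dL simp: power2_eq_square)
    have "(t * M t - Z t * L t) / (Z t * t\<^sup>2) \<le> K * t\<^sup>2 * M t / (Z t * t\<^sup>2)"
      using ent[OF t(1,2)] Zpos[of t] by (intro divide_right_mono) (auto simp: L_def)
    then show "(M t / Z t * t - L t) / t\<^sup>2 - K * (M t / Z t) \<le> 0"
      using Zpos[of t] t by (simp add: divide_simps) (simp add: algebra_simps)
  qed
  \<comment> \<open>At 0 itself \<open>R\<close> has the default value 0, so the two half-lines are
    joined through the limit, the derivative of \<open>L\<close> at 0.\<close>
  have lim: "(R \<longlongrightarrow> M 0) (at 0)"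
  proof -
    have "((\<lambda>h. L h / h) \<longlongrightarrow> M 0) (at 0)"
      using dL[of 0] by (simp add: DERIV_def Z0)
    moreover have "(L \<longlongrightarrow> 0) (at 0)"
      using DERIV_isCont[OF dL[of 0]] by (simp add: isCont_def Z0)
    ultimately have "((\<lambda>t. L t / t - K * L t) \<longlongrightarrow> M 0 - K * 0) (at 0)"
      by (intro tendsto_intros)
    then show ?thesis by (simp add: R_def)
  qed
  have "R l \<le> M 0"
  proof (rule tendsto_lowerbound)
    show "(R \<longlongrightarrow> M 0) (at_right 0)" using lim filterlim_at_split by blast
    have "R l \<le> R t" if "t \<in> {0<..<l}" for t
      by (rule DERIV_nonpos_imp_nonincreasing[of t l R]) (use that s in \<open>auto intro!: dR\<close>)
    then show "\<forall>\<^sub>F t in at_right 0. R l \<le> R t"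
      using eventually_at_right_real[OF l] by (rule eventually_mono[rotated]) auto
  qed simp
  moreover have "M 0 \<le> R (- s)"
  proof (rule tendsto_upperbound)
    show "(R \<longlongrightarrow> M 0) (at_left 0)" using lim filterlim_at_split by blast
    have "R t \<le> R (- s)" if "t \<in> {-s<..<0}" for t
      by (rule DERIV_nonpos_imp_nonincreasing[of "-s" t R]) (use that l in \<open>auto intro!: dR\<close>)
    then show "\<forall>\<^sub>F t in at_left 0. R t \<le> R (- s)"
      using eventually_at_left_real[of "-s" 0] s by (auto elim: eventually_mono)
  qed simp
  ultimately have "R l - R (- s) \<le> 0" by simp
  then show ?thesis by (simp add: R_def L_def algebra_simps)
qed

section \<open>The convex distance\<close>

definition unit_weights :: "nat \<Rightarrow> (nat \<Rightarrow> real) set" where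
  "unit_weights n = {\<alpha>. (\<forall>i<n. 0 \<le> \<alpha> i) \<and> sqrt (\<Sum>i<n. (\<alpha> i)\<^sup>2) \<le> 1}"

lemma d_T_altdef: "d_T n x A = (SUP \<alpha>\<in>unit_weights n. d_alpha_set n \<alpha> x A)"
  by (simp add: d_T_def unit_weights_def)

lemma unit_weights_nonneg: "\<alpha> \<in> unit_weights n \<Longrightarrow> i < n \<Longrightarrow> 0 \<le> \<alpha> i"
  by (simp add: unit_weights_def)

lemma unit_weights_sum: "\<alpha> \<in> unit_weights n \<Longrightarrow> (\<Sum>i<n. (\<alpha> i)\<^sup>2) \<le> 1"
  by (simp add: unit_weights_def)

lemma unit_weights_le_1:
  assumes "\<alpha> \<in> unit_weights n" "i < n"
  shows "\<alpha> i \<le> 1"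
proof -
  have "(\<alpha> i)\<^sup>2 \<le> (\<Sum>i<n. (\<alpha> i)\<^sup>2)" using assms by (intro member_le_sum) auto
  also have "\<dots> \<le> 1" using assms by (simp add: unit_weights_sum)
  finally show ?thesis by (metis one_power2 power2_le_imp_le zero_le_one)
qed

context
  fixes A :: "bool list set"
  assumes A: "finite A" "A \<noteq> {}"
begin

lemma d_alpha_set_le: "y \<in> A \<Longrightarrow> d_alpha_set n \<alpha> x A \<le> d_alpha n \<alpha> x y"
  using A by (simp add: d_alpha_set_def)

lemma d_alpha_set_attained: "\<exists>y\<in>A. d_alpha_set n \<alpha> x A = d_alpha n \<alpha> x y"
proof -
  have "d_alpha_set n \<alpha> x A \<in> (\<lambda>y. d_alpha n \<alpha> x y) ` A"
    unfolding d_alpha_set_def using A by (intro Min_in) auto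
  then show ?thesis by auto
qed

lemma d_alpha_set_bdd: "bdd_above ((\<lambda>\<alpha>. d_alpha_set n \<alpha> x A) ` unit_weights n)"
proof (rule bdd_aboveI2)
  fix \<alpha> assume \<alpha>: "\<alpha> \<in> unit_weights n"
  obtain y where "d_alpha_set n \<alpha> x A = d_alpha n \<alpha> x y" using d_alpha_set_attained by blast
  also have "\<dots> \<le> (\<Sum>i<n. 1)"
    unfolding d_alpha_def using \<alpha> by (intro sum_mono) (auto intro: unit_weights_le_1)
  finally show "d_alpha_set n \<alpha> x A \<le> (\<Sum>i<n. 1)" .
qed

lemma d_alpha_set_le_d_T: "\<alpha> \<in> unit_weights n \<Longrightarrow> d_alpha_set n \<alpha> x A \<le> d_T n x A"
  unfolding d_T_altdef by (intro cSUP_upper d_alpha_set_bdd)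

lemma d_T_nonneg: "0 \<le> d_T n x A"
proof -
  have "d_alpha_set n (\<lambda>_. 0) x A \<le> d_T n x A"
    by (rule d_alpha_set_le_d_T) (simp add: unit_weights_def)
  moreover have "d_alpha_set n (\<lambda>_. 0) x A = 0"
    using d_alpha_set_attained[of n "\<lambda>_. 0" x] by (auto simp: d_alpha_def)
  ultimately show ?thesis by simp
qed

lemma d_T_eq_0:
  assumes "x \<in> A"
  shows "d_T n x A = 0"
proof -
  have "d_T n x A \<le> 0" unfolding d_T_altdef
  proof (rule cSUP_least)
    show "unit_weights n \<noteq> {}" by (auto simp: unit_weights_def intro!: exI[of _ "\<lambda>_. 0"])
    show "d_alpha_set n \<alpha> x A \<le> 0" for \<alpha>
      using d_alpha_set_le[OF assms, of n \<alpha> x] by (simp add: d_alpha_def)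
  qed
  then show ?thesis using d_T_nonneg[of n x] by simp
qed

text \<open>Homogeneity in the weights reduces this to norm one. It is meant for weights with some
  coordinates erased, whose norm has dropped below one.\<close>

lemma d_alpha_set_le_norm_d_T:
  assumes "\<And>i. i < n \<Longrightarrow> 0 \<le> \<alpha> i"
  shows "d_alpha_set n \<alpha> x A \<le> sqrt (\<Sum>i<n. (\<alpha> i)\<^sup>2) * d_T n x A"
proof -
  define r where "r = sqrt (\<Sum>i<n. (\<alpha> i)\<^sup>2)"
  have r0: "r \<ge> 0" by (simp add: r_def sum_nonneg)
  show ?thesis
  proof (cases "r = 0")
    case True
    then have "(\<Sum>i<n. (\<alpha> i)\<^sup>2) = 0" by (simp add: r_def)
    then have "\<forall>i<n. \<alpha> i = 0" by (simp add: sum_nonneg_eq_0_iff)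
    then have "d_alpha n \<alpha> x y = 0" for y by (simp add: d_alpha_def)
    then have "d_alpha_set n \<alpha> x A = 0" using d_alpha_set_attained by metis
    then show ?thesis using True by (simp add: r_def)
  next
    case False
    define \<beta> where "\<beta> = (\<lambda>i. \<alpha> i / r)"
    have "(\<Sum>i<n. (\<beta> i)\<^sup>2) = (\<Sum>i<n. (\<alpha> i)\<^sup>2) / r\<^sup>2"
      by (simp add: \<beta>_def power_divide sum_divide_distrib)
    also have "\<dots> = 1" using False by (simp add: r_def sum_nonneg)
    finally have "\<beta> \<in> unit_weights n" using assms r0 by (simp add: unit_weights_def \<beta>_def)
    then have *: "d_alpha_set n \<beta> x A \<le> d_T n x A" by (rule d_alpha_set_le_d_T)
    obtain y where y: "y \<in> A" "d_alpha_set n \<beta> x A = d_alpha n \<beta> x y" using d_alpha_set_attained by blast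
    have "d_alpha_set n \<alpha> x A \<le> d_alpha n \<alpha> x y" using y by (intro d_alpha_set_le)
    also have "\<dots> = r * d_alpha n \<beta> x y"
      using False by (simp add: d_alpha_def \<beta>_def sum_distrib_left)
    also have "\<dots> \<le> r * d_T n x A" using * y r0 by (intro mult_left_mono) auto
    finally show ?thesis by (simp add: r_def)
  qed
qed

text \<open>Coordinates from \<open>n\<close> on are unconstrained in \<open>unit_weights\<close>,
  so the maximum is taken over the set \<open>K\<close> with all coordinates in [0,1], compact by
  Tychonoff. The objective is a minimum of finitely many continuous functions, and setting
  irrelevant coordinates to 0 does not change it.\<close>

lemma d_T_attained: "\<exists>\<alpha>\<in>unit_weights n. d_T n x A = d_alpha_set n \<alpha> x A"
proof -
  define K where "K = {\<alpha>::nat \<Rightarrow> real. \<forall>i. \<alpha> i \<in> {0..1}} \<inter> {\<alpha>. (\<Sum>i<n. (\<alpha> i)\<^sup>2) \<le> 1}"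
  have "compact {\<alpha>::nat \<Rightarrow> real. \<forall>i. \<alpha> i \<in> {0..1}}"
  proof -
    have "compactin (product_topology (\<lambda>i::nat. euclidean :: real topology) UNIV) (PiE UNIV (\<lambda>_. {0..1}))"
      by (subst compactin_PiE) auto
    then show ?thesis by (simp add: euclidean_product_topology PiE_UNIV_domain Pi_def)
  qed
  moreover have "closed {\<alpha>::nat \<Rightarrow> real. (\<Sum>i<n. (\<alpha> i)\<^sup>2) \<le> 1}"
    by (intro closed_Collect_le continuous_intros continuous_on_product_coordinates)
  ultimately have K: "compact K" unfolding K_def by (rule compact_Int_closed)
  have coord: "continuous_on K (\<lambda>\<alpha>. \<alpha> i)" for i
    by (rule continuous_on_subset [OF continuous_on_product_coordinates]) simp
  have cont: "continuous_on K (\<lambda>\<alpha>. d_alpha_set n \<alpha> x A)"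
  proof -
    have "continuous_on K (\<lambda>\<alpha>. Min ((\<lambda>y. d_alpha n \<alpha> x y) ` B))" if "finite B" "B \<noteq> {}" for B
      using that
    proof (induction B rule: finite_ne_induct)
      case (singleton y)
      then show ?case unfolding d_alpha_def
        by (auto intro!: continuous_intros coord)
    next
      case (insert y B)
      have "continuous_on K (\<lambda>\<alpha>. d_alpha n \<alpha> x y)" unfolding d_alpha_def
        by (auto intro!: continuous_intros coord)
      then show ?case using insert by (simp add: continuous_on_min)
    qed
    then show ?thesis unfolding d_alpha_set_def using A by blast
  qed
  have "K \<noteq> {}" by (auto simp: K_def intro!: exI[of _ "\<lambda>_. 0"])
  then obtain \<alpha> where \<alpha>: "\<alpha> \<in> K" "\<And>\<beta>. \<beta> \<in> K \<Longrightarrow> d_alpha_set n \<beta> x A \<le> d_alpha_set n \<alpha> x A"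
    using continuous_attains_sup[OF K _ cont] by blast
  have \<alpha>U: "\<alpha> \<in> unit_weights n" using \<alpha>(1) by (auto simp: K_def unit_weights_def)
  have "d_T n x A \<le> d_alpha_set n \<alpha> x A" unfolding d_T_altdef
  proof (rule cSUP_least)
    show "unit_weights n \<noteq> {}" using \<alpha>U by auto
    fix \<beta> assume \<beta>: "\<beta> \<in> unit_weights n"
    define \<gamma> where "\<gamma> = (\<lambda>i. if i < n then \<beta> i else 0)"
    have "\<gamma> \<in> K" using \<beta> unit_weights_le_1[OF \<beta>] by (auto simp: K_def \<gamma>_def unit_weights_def)
    moreover have "d_alpha_set n \<beta> x A = d_alpha_set n \<gamma> x A"
      by (simp add: d_alpha_set_def d_alpha_def \<gamma>_def)
    ultimately show "d_alpha_set n \<beta> x A \<le> d_alpha_set n \<alpha> x A" using \<alpha>(2) by simp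
  qed
  then show ?thesis using \<alpha>U d_alpha_set_le_d_T[OF \<alpha>U] by (auto intro: antisym)
qed

text \<open>Erase the weights at \<open>i\<close> and \<open>j\<close>: the remaining
  \<open>\<beta>\<close> cannot tell \<open>x\<close> from \<open>y\<close>. A point of
  \<open>A\<close> nearest to \<open>y\<close> for \<open>\<beta>\<close> is then tested against
  \<open>x\<close>, at extra cost at most \<open>\<alpha> i + \<alpha> j\<close>. The loss of norm
  in \<open>\<beta>\<close> supplies the square root.\<close>

lemma d_T_swap_le:
  assumes \<alpha>: "\<alpha> \<in> unit_weights n" "d_T n x A = d_alpha_set n \<alpha> x A"
    and ij: "i < n" "j < n" "i \<noteq> j" and xy: "\<And>m. m < n \<Longrightarrow> m \<noteq> i \<Longrightarrow> m \<noteq> j \<Longrightarrow> x ! m = y ! m"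
  shows "d_T n x A \<le> sqrt (1 - (\<alpha> i)\<^sup>2 - (\<alpha> j)\<^sup>2) * d_T n y A + (\<alpha> i + \<alpha> j)"
proof -
  define \<beta> where "\<beta> = \<alpha>(i := 0, j := 0)"
  have split: "(\<Sum>m<n. g m) = g i + g j + (\<Sum>m\<in>{..<n} - {i} - {j}. g m)" for g :: "nat \<Rightarrow> real"
    using ij by (simp add: sum.remove[of "{..<n}" i] sum.remove[of "{..<n} - {i}" j])
  obtain z where z: "z \<in> A" "d_alpha_set n \<beta> y A = d_alpha n \<beta> y z" using d_alpha_set_attained by blast
  have "d_T n x A \<le> d_alpha n \<alpha> x z" using \<alpha>(2) z(1) d_alpha_set_le by simp
  also have "\<dots> \<le> d_alpha n \<beta> y z + (\<alpha> i + \<alpha> j)"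
  proof -
    have "(\<Sum>m\<in>{..<n} - {i} - {j}. \<alpha> m * (if x ! m \<noteq> z ! m then 1 else 0)) =
       (\<Sum>m\<in>{..<n} - {i} - {j}. \<beta> m * (if y ! m \<noteq> z ! m then 1 else 0))"
      using xy by (intro sum.cong) (auto simp: \<beta>_def)
    then show ?thesis
      using ij \<alpha>(1) unfolding d_alpha_def by (simp add: split \<beta>_def unit_weights_nonneg)
  qed
  also have "d_alpha n \<beta> y z \<le> sqrt (\<Sum>m<n. (\<beta> m)\<^sup>2) * d_T n y A"
    unfolding z(2)[symmetric] using \<alpha>(1)
    by (intro d_alpha_set_le_norm_d_T) (auto simp: \<beta>_def unit_weights_nonneg)
  also have "sqrt (\<Sum>m<n. (\<beta> m)\<^sup>2) * d_T n y A \<le> sqrt (1 - (\<alpha> i)\<^sup>2 - (\<alpha> j)\<^sup>2) * d_T n y A"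
  proof (intro mult_right_mono real_sqrt_le_mono d_T_nonneg)
    have "(\<Sum>m\<in>{..<n} - {i} - {j}. (\<beta> m)\<^sup>2) = (\<Sum>m\<in>{..<n} - {i} - {j}. (\<alpha> m)\<^sup>2)"
      by (intro sum.cong) (auto simp: \<beta>_def)
    then show "(\<Sum>m<n. (\<beta> m)\<^sup>2) \<le> 1 - (\<alpha> i)\<^sup>2 - (\<alpha> j)\<^sup>2"
      using unit_weights_sum[OF \<alpha>(1)] ij by (simp add: split) (simp add: \<beta>_def)
  qed
  finally show ?thesis by simp
qed

text \<open>The first bound exploits the loss of norm and is uniform in the size of the distance.
  The second discards it: the difference of distances is at most
  \<open>\<alpha> i + \<alpha> j\<close>, and their sum at most twice the larger.\<close>

lemma d_T_sq_swap_le: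
  assumes \<alpha>: "\<alpha> \<in> unit_weights n" "d_T n x A = d_alpha_set n \<alpha> x A"
    and ij: "i < n" "j < n" "i \<noteq> j" and xy: "\<And>m. m < n \<Longrightarrow> m \<noteq> i \<Longrightarrow> m \<noteq> j \<Longrightarrow> x ! m = y ! m"
    and le: "(d_T n y A)\<^sup>2 \<le> (d_T n x A)\<^sup>2"
  shows "(d_T n x A)\<^sup>2 - (d_T n y A)\<^sup>2 \<le> 2"
    and "((d_T n x A)\<^sup>2 - (d_T n y A)\<^sup>2)\<^sup>2 \<le> 8 * (d_T n x A)\<^sup>2 * ((\<alpha> i)\<^sup>2 + (\<alpha> j)\<^sup>2)"
proof -
  define a b u where "a = d_T n x A" and "b = d_T n y A" and "u = \<alpha> i + \<alpha> j"
  define c where "c = sqrt (1 - (\<alpha> i)\<^sup>2 - (\<alpha> j)\<^sup>2)"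
  have ab: "a \<ge> 0" "b \<ge> 0" by (simp_all add: a_def b_def d_T_nonneg)
  have u: "u \<ge> 0" using \<alpha>(1) ij by (simp add: u_def unit_weights_nonneg)
  have "(\<alpha> i)\<^sup>2 + (\<alpha> j)\<^sup>2 = (\<Sum>m\<in>{i, j}. (\<alpha> m)\<^sup>2)" using ij by simp
  also have "\<dots> \<le> (\<Sum>m<n. (\<alpha> m)\<^sup>2)" using ij by (intro sum_mono2) auto
  also have "\<dots> \<le> 1" using \<alpha>(1) by (rule unit_weights_sum)
  finally have c2: "c\<^sup>2 = 1 - ((\<alpha> i)\<^sup>2 + (\<alpha> j)\<^sup>2)" and c1: "0 \<le> c" "c \<le> 1"
    by (auto simp: c_def)
  have u2: "u\<^sup>2 \<le> 2 * ((\<alpha> i)\<^sup>2 + (\<alpha> j)\<^sup>2)"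
    using zero_le_power2[of "\<alpha> i - \<alpha> j"] by (simp add: u_def power2_eq_square algebra_simps)
  have acb: "a \<le> c * b + u" unfolding a_def b_def c_def u_def by (rule d_T_swap_le) (use assms in auto)
  then have "a\<^sup>2 \<le> (c * b + u)\<^sup>2" using ab(1) by (rule power_mono)
  \<comment> \<open>Cauchy-Schwarz for (c, u / sqrt 2) and (b, sqrt 2), the first vector having norm
    at most 1. The square of \<open>u * b - 2 * c\<close> is twice the defect.\<close>
  moreover have "(c * b + u)\<^sup>2 \<le> b\<^sup>2 + 2"
  proof -
    have "b\<^sup>2 * u\<^sup>2 \<le> b\<^sup>2 * (2 - 2 * c\<^sup>2)" using u2 c2 by (intro mult_left_mono) auto
    moreover have "0 \<le> (u * b - 2 * c)\<^sup>2" by simp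
    moreover have "u\<^sup>2 \<le> 2 - 2 * c\<^sup>2" using u2 c2 by simp
    ultimately show ?thesis by (simp add: power2_eq_square algebra_simps)
  qed
  ultimately show "(d_T n x A)\<^sup>2 - (d_T n y A)\<^sup>2 \<le> 2" by (simp add: a_def b_def)
  have "b \<le> a" 
    by (rule power2_le_imp_le) (use le ab in \<open>auto simp: a_def b_def\<close>)
  have "c * b \<le> b" using c1 ab by (simp add: mult_left_le_one_le)
  then have "a - b \<le> u" using acb by simp
  then have "(a - b) * (a + b) \<le> u * (2 * a)"
    using \<open>b \<le> a\<close> ab u by (intro mult_mono) auto
  then have "((a - b) * (a + b))\<^sup>2 \<le> (u * (2 * a))\<^sup>2"
    using \<open>b \<le> a\<close> ab by (intro power_mono) auto
  also have "\<dots> = 4 * a\<^sup>2 * u\<^sup>2" by (simp add: power_mult_distrib)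
  also have "\<dots> \<le> 4 * a\<^sup>2 * (2 * ((\<alpha> i)\<^sup>2 + (\<alpha> j)\<^sup>2))" using u2 by (intro mult_left_mono) auto
  finally show "((d_T n x A)\<^sup>2 - (d_T n y A)\<^sup>2)\<^sup>2 \<le> 8 * (d_T n x A)\<^sup>2 * ((\<alpha> i)\<^sup>2 + (\<alpha> j)\<^sup>2)"
    by (simp add: a_def b_def power2_eq_square algebra_simps)
qed

end

section \<open>Estimates for exponentials and their entropy\<close>

lemma exp_diff_le:
  fixes u :: real
  assumes "0 \<le> u" "u \<le> 1"
  shows "exp u - 1 \<le> 2 * u"
proof -
  have "exp u \<le> 1 + u + u\<^sup>2" using assms by (rule exp_bound)
  moreover have "u\<^sup>2 \<le> u" using assms by (simp add: power2_eq_square mult_left_le)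
  ultimately show ?thesis by simp
qed

text \<open>The bound carries the exponential at the larger value \<open>a\<close> for either sign
  of \<open>t\<close>. For negative \<open>t\<close> that is the smaller exponential, short by a
  factor exp(u) with u = - t (a - b). The limits 2 and -1/2 keep u at most 1, and the factor 2 comes
  from exp(u) - 1 being at most 2u.\<close>

lemma psi_exp_le:
  fixes a b t :: real
  assumes "b \<le> a" "a - b \<le> 2" "- (1 / 2) \<le> t"
  shows "psi (exp (t * a)) (exp (t * b)) \<le> 2 * t\<^sup>2 * (a - b)\<^sup>2 * exp (t * a)"
proof -
  define d where "d = a - b"
  have d: "0 \<le> d" "d \<le> 2" using assms by (auto simp: d_def)
  have e: "exp (t * b) = exp (t * a) * exp (- (t * d))"
    by (simp add: d_def algebra_simps flip: exp_add)
  have psi: "psi (exp (t * a)) (exp (t * b)) = exp (t * a) * (t * d * (1 - exp (- (t * d))))"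
    unfolding psi_def ln_exp by (simp add: e) (simp add: d_def algebra_simps)
  have "t * d * (1 - exp (- (t * d))) \<le> 2 * (t * d)\<^sup>2"
  proof (cases "t \<ge> 0")
    case True
    have "1 - exp (- (t * d)) \<le> t * d" using exp_ge_add_one_self[of "- (t * d)"] by simp
    then have "t * d * (1 - exp (- (t * d))) \<le> t * d * (t * d)"
      using True d by (intro mult_left_mono) auto
    also have "\<dots> \<le> 2 * (t * d)\<^sup>2" by (simp add: power2_eq_square [of "t * d", symmetric])
    finally show ?thesis .
  next
    case False
    define u where "u = - (t * d)"
    have "- t * d \<le> (1 / 2) * 2" using False assms(3) d by (intro mult_mono) auto
    then have u: "0 \<le> u" "u \<le> 1" using False d by (auto simp: u_def mult_nonpos_nonneg)
    have "u * (exp u - 1) \<le> u * (2 * u)" using u by (intro mult_left_mono exp_diff_le) auto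
    moreover have "t * d = - u" by (simp add: u_def)
    ultimately show ?thesis by (simp add: power2_eq_square algebra_simps)
  qed
  then have "exp (t * a) * (t * d * (1 - exp (- (t * d)))) \<le> exp (t * a) * (2 * (t * d)\<^sup>2)"
    by (intro mult_left_mono) auto
  then show ?thesis unfolding psi by (simp add: d_def power_mult_distrib mult_ac)
qed

lemma ent_scale:
  assumes "c \<noteq> 0"
  shows "ent D (\<lambda>S. c * w S) F = c * ent D w F"
  using assms by (simp add: ent_def mult.assoc sum_distrib_left [symmetric] algebra_simps)

lemma ent_exp:
  assumes "sum w D = 1"
  shows "ent D w (\<lambda>S. exp (t * f S)) = t * (\<Sum>S\<in>D. w S * (f S * exp (t * f S)))
     - (\<Sum>S\<in>D. w S * exp (t * f S)) * ln (\<Sum>S\<in>D. w S * exp (t * f S))"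
  using assms by (simp add: ent_def sum_distrib_left mult_ac)

section \<open>Conditioned Bernoulli laws\<close>

definition list_of :: "nat \<Rightarrow> nat set \<Rightarrow> bool list" where
  "list_of n S = map (\<lambda>i. i \<in> S) [0..<n]"

lemma length_list_of [simp]: "length (list_of n S) = n"
  by (simp add: list_of_def)

lemma nth_list_of [simp]: "i < n \<Longrightarrow> list_of n S ! i \<longleftrightarrow> i \<in> S"
  by (simp add: list_of_def)

lemma bij_list_of: "bij_betw (list_of n) (slice {} {..<n} k) {x \<in> cube n. ones x = k}"
proof (rule bij_betw_byWitness[where f' = "\<lambda>x. {i. i < length x \<and> x ! i}"])
  have *: "{i. i < n \<and> list_of n S ! i} = S" if "S \<subseteq> {..<n}" for S
    using that by (auto simp: lessThan_def)
  then show "\<forall>S\<in>slice {} {..<n} k. {i. i < length (list_of n S) \<and> list_of n S ! i} = S"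
    by (auto simp: slice_def)
  show "\<forall>x\<in>{x \<in> cube n. ones x = k}. list_of n {i. i < length x \<and> x ! i} = x"
    by (auto simp: cube_def intro!: nth_equalityI)
  show "list_of n ` slice {} {..<n} k \<subseteq> {x \<in> cube n. ones x = k}"
    using * by (auto simp: slice_def cube_def ones_def)
  show "(\<lambda>x. {i. i < length x \<and> x ! i}) ` {x \<in> cube n. ones x = k} \<subseteq> slice {} {..<n} k"
    by (auto simp: slice_def cube_def ones_def)
qed

lemma finite_cube: "finite (cube n)"
  using finite_lists_length_eq[of "UNIV :: bool set" n] by (simp add: cube_def)

text \<open>Pulling out every failure probability leaves the odds over \<open>S\<close>; the common
  factor cancels under conditioning.\<close>

lemma bern_weight_list_of:
  assumes p: "\<forall>i<n. 0 < p i \<and> p i < 1" and S: "S \<subseteq> {..<n}"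
  shows "bern_weight p (list_of n S) = (\<Prod>i<n. 1 - p i) * (\<Prod>i\<in>S. p i / (1 - p i))"
proof -
  have "bern_weight p (list_of n S) = (\<Prod>i<n. (1 - p i) * (if i \<in> S then p i / (1 - p i) else 1))"
    unfolding bern_weight_def using p by (intro prod.cong) (auto simp: less_imp_neq)
  also have "\<dots> = (\<Prod>i<n. 1 - p i) * (\<Prod>i\<in>{..<n} \<inter> S. p i / (1 - p i))"
    by (simp add: prod.distrib prod.inter_restrict)
  also have "{..<n} \<inter> S = S" using S by auto
  finally show ?thesis .
qed

lemma cb_expect_slice:
  fixes p :: "nat \<Rightarrow> real"
  defines "w \<equiv> \<lambda>i. p i / (1 - p i)"
  assumes p: "\<forall>i<n. 0 < p i \<and> p i < 1"
  shows "cb_expect n p k g =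
    (\<Sum>S\<in>slice {} {..<n} k. 1 / (\<Sum>S\<in>slice {} {..<n} k. prod w S) * prod w S * g (list_of n S))"
proof -
  let ?\<Omega> = "slice {} {..<n} k" and ?c = "\<Prod>i<n. 1 - p i"
  have c: "?c \<noteq> 0" using p by auto
  have bw: "bern_weight p (list_of n S) = ?c * prod w S" if "S \<in> ?\<Omega>" for S
    unfolding w_def using that by (intro bern_weight_list_of p) (auto simp: slice_def)
  have Z: "(\<Sum>y\<in>{y\<in>cube n. ones y = k}. bern_weight p y) = ?c * (\<Sum>S\<in>?\<Omega>. prod w S)"
    using bw by (simp add: sum.reindex_bij_betw[OF bij_list_of, symmetric] sum_distrib_left)
  have "cb_expect n p k g = (\<Sum>x\<in>{x\<in>cube n. ones x = k}. cond_bern n p k x * g x)"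
    unfolding cb_expect_def using finite_cube
    by (intro sum.mono_neutral_right) (auto simp: cond_bern_def)
  also have "\<dots> = (\<Sum>x\<in>{x\<in>cube n. ones x = k}. bern_weight p x / (?c * (\<Sum>S\<in>?\<Omega>. prod w S)) * g x)"
    unfolding Z [symmetric] by (intro sum.cong) (auto simp: cond_bern_def)
  also have "\<dots> = (\<Sum>S\<in>?\<Omega>. ?c * prod w S / (?c * (\<Sum>S\<in>?\<Omega>. prod w S)) * g (list_of n S))"
    unfolding sum.reindex_bij_betw [OF bij_list_of, symmetric] using bw by (intro sum.cong refl) simp
  also have "\<dots> = (\<Sum>S\<in>?\<Omega>. 1 / (\<Sum>S\<in>?\<Omega>. prod w S) * prod w S * g (list_of n S))"
    using c by (intro sum.cong refl) simp
  finally show ?thesis .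
qed

section \<open>Entropy bound for exponentials of the squared convex distance, and the
  conclusion\<close>

lemma ent_exp_d_T_sq_le:
  fixes A :: "bool list set" and n k :: nat and w :: "nat \<Rightarrow> real"
  defines "f \<equiv> \<lambda>S. (d_T n (list_of n S) A)\<^sup>2"
  assumes A: "finite A" "A \<noteq> {}" and w: "\<And>i. i < n \<Longrightarrow> 0 < w i" and t: "- (1 / 2) \<le> t"
  shows "ent (slice {} {..<n} k) (prod w) (\<lambda>S. exp (t * f S))
    \<le> 32 * t\<^sup>2 * (\<Sum>S\<in>slice {} {..<n} k. prod w S * (f S * exp (t * f S)))"
proof -
  let ?\<Omega> = "slice {} {..<n} k"
  have "\<forall>x. \<exists>\<alpha>. \<alpha> \<in> unit_weights n \<and> d_T n x A = d_alpha_set n \<alpha> x A"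
    using d_T_attained[OF A] by blast
  then obtain a where a: "\<And>x. a x \<in> unit_weights n" "\<And>x. d_T n x A = d_alpha_set n (a x) x A"
    by metis
  \<comment> \<open>The constant 16 is 2 from \<open>psi_exp_le\<close> times 8 from
    \<open>d_T_sq_swap_le\<close>. Summing over \<open>i\<close> removes the squared weights, and
    the Sobolev constant 2 then gives 32.\<close>
  define h where "h = (\<lambda>S i. 16 * t\<^sup>2 * (f S * exp (t * f S)) * (a (list_of n S) i)\<^sup>2)"
  have h0: "0 \<le> h S i" for S i by (simp add: h_def f_def)
  have one_side: "psi (exp (t * f S)) (exp (t * f S')) \<le> h S i + h S j"
    if ij: "i < n" "j < n" "i \<noteq> j" and SS': "\<And>m. m < n \<Longrightarrow> m \<noteq> i \<Longrightarrow> m \<noteq> j \<Longrightarrow> m \<in> S \<longleftrightarrow> m \<in> S'"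
      and le: "f S' \<le> f S" for S S' i j
  proof -
    note * = d_T_sq_swap_le[OF A a(1)[of "list_of n S"] a(2) ij, of "list_of n S'"]
    have 1: "f S - f S' \<le> 2"
      unfolding f_def by (rule *(1)) (use SS' le in \<open>auto simp: f_def\<close>)
    have 2: "(f S - f S')\<^sup>2 \<le> 8 * f S * ((a (list_of n S) i)\<^sup>2 + (a (list_of n S) j)\<^sup>2)"
      unfolding f_def by (rule *(2)) (use SS' le in \<open>auto simp: f_def\<close>)
    have "psi (exp (t * f S)) (exp (t * f S')) \<le> 2 * t\<^sup>2 * (f S - f S')\<^sup>2 * exp (t * f S)"
      by (rule psi_exp_le[OF le 1 t])
    also have "\<dots> \<le> 2 * t\<^sup>2 * (8 * f S * ((a (list_of n S) i)\<^sup>2 + (a (list_of n S) j)\<^sup>2)) * exp (t * f S)"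
      using 2 by (intro mult_left_mono mult_right_mono) auto
    also have "\<dots> = h S i + h S j" by (simp add: h_def algebra_simps)
    finally show ?thesis .
  qed
  have "ent ?\<Omega> (prod w) (\<lambda>S. exp (t * f S)) \<le> 2 * (\<Sum>S\<in>?\<Omega>. prod w S * (\<Sum>i\<in>{..<n}. h S i))"
  proof (rule modified_log_sobolev_slice)
    fix S i j assume S: "S \<subseteq> {} \<union> {..<n}" "i \<in> S" "j \<in> {} \<union> {..<n}" "j \<notin> S"
    then have ij: "i < n" "j < n" "i \<noteq> j" by auto
    have S': "m \<in> S \<longleftrightarrow> m \<in> swap i j S" if "m \<noteq> i" "m \<noteq> j" for m using that by (auto simp: swap_def)
    show "psi (exp (t * f S)) (exp (t * f (swap i j S)))
       \<le> h S i + h S j + h (swap i j S) i + h (swap i j S) j"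
    \<comment> \<open>The end point with the larger \<open>f\<close> pays for the whole exchange,
      through its own optimal weights; the terms of the other are merely nonnegative.\<close>
    proof (cases "f (swap i j S) \<le> f S")
      case True
      have "psi (exp (t * f S)) (exp (t * f (swap i j S))) \<le> h S i + h S j"
        by (rule one_side[OF ij _ True]) (use S' in auto)
      then show ?thesis using h0[of "swap i j S" i] h0[of "swap i j S" j] by simp
    next
      case False
      have "psi (exp (t * f (swap i j S))) (exp (t * f S)) \<le> h (swap i j S) i + h (swap i j S) j"
        by (rule one_side[OF ij]) (use S' False in auto)
      then show ?thesis using h0[of S i] h0[of S j] by (simp add: psi_commute)
    qed
  qed (use w h0 in auto)
  also have "\<dots> \<le> 2 * (\<Sum>S\<in>?\<Omega>. prod w S * (16 * t\<^sup>2 * (f S * exp (t * f S))))"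
  proof (intro mult_left_mono sum_mono)
    fix S assume "S \<in> ?\<Omega>"
    then show "0 \<le> prod w S" using w by (intro prod_nonneg) (auto simp: slice_def less_imp_le subset_iff)
    have "(\<Sum>i<n. h S i) = 16 * t\<^sup>2 * (f S * exp (t * f S)) * (\<Sum>i<n. (a (list_of n S) i)\<^sup>2)"
      by (simp add: h_def sum_distrib_left)
    also have "\<dots> \<le> 16 * t\<^sup>2 * (f S * exp (t * f S)) * 1"
      using a(1) by (intro mult_left_mono unit_weights_sum) (auto simp: f_def)
    finally show "(\<Sum>i\<in>{..<n}. h S i) \<le> 16 * t\<^sup>2 * (f S * exp (t * f S))" by simp
  qed simp
  also have "\<dots> = 32 * t\<^sup>2 * (\<Sum>S\<in>?\<Omega>. prod w S * (f S * exp (t * f S)))"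
    by (simp add: sum_distrib_left mult_ac)
  finally show ?thesis .
qed

theorem theorem3p1:
  fixes n k :: nat and p :: "nat \<Rightarrow> real" and A :: "bool list set"
  assumes "\<forall>i<n. 0 < p i \<and> p i < 1"
    and "k \<le> n"
    and "A \<subseteq> cube n" and "A \<noteq> {}"
  shows "cb_prob n p k A * cb_expect n p k (\<lambda>x. exp ((d_T n x A)\<^sup>2 / 84)) \<le> 1"
proof -
  let ?\<Omega> = "slice {} {..<n} k"
  have A: "finite A" "A \<noteq> {}" using finite_subset[OF assms(3) finite_cube] assms(4) by auto
  define w where "w = (\<lambda>i. p i / (1 - p i))"
  define c where "c = 1 / (\<Sum>S\<in>?\<Omega>. prod w S)"
  define f where "f = (\<lambda>S. (d_T n (list_of n S) A)\<^sup>2)"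
  define Z where "Z = (\<lambda>t. \<Sum>S\<in>?\<Omega>. c * prod w S * exp (t * f S))"
  have w: "w i > 0" if "i < n" for i using assms(1) that by (simp add: w_def)
  have pw: "prod w S > 0" if "S \<in> ?\<Omega>" for S
    using that w by (intro prod_pos) (auto simp: slice_def)
  have "{..<k} \<in> ?\<Omega>" using assms(2) by (auto simp: slice_def)
  then have ne: "?\<Omega> \<noteq> {}" by auto
  have c: "c > 0" unfolding c_def using pw ne by (intro divide_pos_pos sum_pos) auto
  have norm: "(\<Sum>S\<in>?\<Omega>. c * prod w S) = 1"
    using c by (simp add: c_def flip: sum_divide_distrib)
  have E: "cb_expect n p k g = (\<Sum>S\<in>?\<Omega>. c * prod w S * g (list_of n S))" for g
    unfolding c_def w_def by (rule cb_expect_slice[OF assms(1)])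
  have Zpos: "Z t > 0" for t
    unfolding Z_def using ne pw c by (intro sum_pos) auto
  have "t * (\<Sum>S\<in>?\<Omega>. c * prod w S * (f S * exp (t * f S))) - Z t * ln (Z t)
      \<le> 32 * t\<^sup>2 * (\<Sum>S\<in>?\<Omega>. c * prod w S * (f S * exp (t * f S)))" if "- (1 / 2) \<le> t" for t
  proof -
    have "ent ?\<Omega> (prod w) (\<lambda>S. exp (t * f S)) \<le> 32 * t\<^sup>2 * (\<Sum>S\<in>?\<Omega>. prod w S * (f S * exp (t * f S)))"
      unfolding f_def using w by (intro ent_exp_d_T_sq_le A that)
    then have "c * ent ?\<Omega> (prod w) (\<lambda>S. exp (t * f S))
        \<le> c * (32 * t\<^sup>2 * (\<Sum>S\<in>?\<Omega>. prod w S * (f S * exp (t * f S))))"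
      using c by (intro mult_left_mono) auto
    moreover have "c * ent ?\<Omega> (prod w) (\<lambda>S. exp (t * f S)) =
       t * (\<Sum>S\<in>?\<Omega>. c * prod w S * (f S * exp (t * f S))) - Z t * ln (Z t)"
      unfolding Z_def using c ent_scale[of c ?\<Omega> "prod w"] ent_exp[OF norm, of t f] by simp
    ultimately show ?thesis by (simp add: sum_distrib_left mult_ac)
  qed
  then have H: "(1 / (1 / 84) - 32) * ln (Z (1 / 84)) + (1 / (1 / 2) + 32) * ln (Z (- (1 / 2))) \<le> 0"
    unfolding Z_def
    by (intro herbst_two_sided) (use c pw norm in auto)
  have "ln (Z (1 / 84)) \<ge> 0"
  proof -
    have "(\<Sum>S\<in>?\<Omega>. c * prod w S * 1) \<le> Z (1 / 84)"
      unfolding Z_def using c pw by (intro sum_mono mult_left_mono) (auto simp: f_def less_imp_le)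
    then show ?thesis using norm by simp
  qed
  \<comment> \<open>The coefficients in \<open>H\<close> are 84 - 32 = 52 and 2 + 32 = 34.
    Nonnegativity of the first logarithm allows 52 to be lowered to 34, which then divides
    out.\<close>
  with H have "ln (Z (1 / 84)) + ln (Z (- (1 / 2))) \<le> 0" by simp
  then have "ln (Z (- (1 / 2)) * Z (1 / 84)) \<le> 0"
    using Zpos[of "1 / 84"] Zpos[of "- (1 / 2)"] by (simp add: ln_mult)
  then have ZZ: "Z (- (1 / 2)) * Z (1 / 84) \<le> 1"
    using Zpos[of "1 / 84"] Zpos[of "- (1 / 2)"] by (simp add: ln_le_zero_iff)
  \<comment> \<open>The distance vanishes on \<open>A\<close>, so the indicator of \<open>A\<close>
    lies below exp(-f/2).\<close>
  have P: "cb_prob n p k A \<le> Z (- (1 / 2))"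
  proof -
    have "cb_prob n p k A = cb_expect n p k (\<lambda>x. if x \<in> A then 1 else 0)"
      unfolding cb_prob_def cb_expect_def using finite_cube
      by (subst Int_commute) (simp add: sum.inter_restrict if_distrib cong: if_cong)
    also have "\<dots> \<le> Z (- (1 / 2))"
      unfolding E Z_def
      using c pw by (intro sum_mono mult_left_mono) (auto simp: f_def d_T_eq_0[OF A] less_imp_le)
    finally show ?thesis .
  qed
  have "cb_expect n p k (\<lambda>x. exp ((d_T n x A)\<^sup>2 / 84)) = Z (1 / 84)"
    unfolding E Z_def f_def by simp
  then have "cb_prob n p k A * cb_expect n p k (\<lambda>x. exp ((d_T n x A)\<^sup>2 / 84)) \<le> Z (- (1 / 2)) * Z (1 / 84)"
    using mult_right_mono [OF P less_imp_le [OF Zpos]] by simp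
  also note ZZ
  finally show ?thesis .
qed

end
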